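(* (The Uniform Boundedness Principle) Let $E$ be a real Banach space, let $P\subseteq E$ be a normal cone with $\operatorname{int}P\neq\varnothing$ having the supremum property, and fix $c_0\in E$ with $0\ll c_0$. Let $(X,\|\cdot\|_p)$ be a cone Banach space and $(Y,\|\cdot\|_p)$ be a cone normed space (both with respect to $E$ and $P$). Suppose $A\subseteq B(X,Y)$ is pointwise bounded, that is, for each $x\in X$ the set $\{Tx : T\in A\}$ is cone bounded in $Y$. Then $A$ is a cone bounded set in $B(X,Y)$.
   Context: Let $E$ be a real Banach space with norm $\|\cdot\|$. A subset $P\subseteq E$ is a cone if (1) $P$ is closed, non-empty and $P\neq\{0\}$; (2) $ax+by\in P$ for all $x,y\in P$ and real $a,b\ge 0$; (3) $P\cap(-P)=\{0\}$. Write $x\le y$ iff $y-x\in P$, and $x\ll y$ iff $y-x\in\operatorname{int}P$, where $\operatorname{int}P$ is the interior of $P$ in $E$. The cone $P$ is normal if there is a number $M>0$ such that for all $x,y\in E$, $0\le x\le y$ implies $\|x\|\le M\|y\|$. A subset $S\subseteq E$ is upper bounded if there exists $t\in E$ with $0\le t$ such that $a\le t$ for all $a\in S$; such a $t$ is called an upper bound for $S$. $P$ has the supremum property if every upper bounded set $S\subseteq P$ has a least upper bound in $P$, denoted $\sup S$. A cone normed space $(X,\|\cdot\|_p)$ is a real vector space $X$ with a map $\|\cdot\|_p:X\to E$ such that (1) $\|x\|_p\ge 0$ for all $x\in X$, and $\|x\|_p=0$ iff $x=0$; (2) $\|\alpha x\|_p=|\alpha|\,\|x\|_p$ for all $x\in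 X$, $\alpha\in\mathbb{R}$; (3) $\|x+y\|_p\le\|x\|_p+\|y\|_p$ for all $x,y\in X$. (The same symbol $\|\cdot\|_p$ is used for the cone norms of different spaces.) A sequence $\{x_n\}$ in $X$ converges to $x\in X$ if for every $c\in E$ with $0\ll c$ there is a positive integer $N$ such that $\|x_n-x\|_p\ll c$ for all $n\ge N$. It is Cauchy if for every $c\in E$ with $0\ll c$ there is a positive integer $N$ such that $\|x_n-x_m\|_p\ll c$ for all $n,m\ge N$. $(X,\|\cdot\|_p)$ is a cone Banach space if every Cauchy sequence in $X$ converges to a point of $X$. A subset $S$ of a cone normed space is cone bounded if $\{\|x\|_p : x\in S\}$ is upper bounded in $E$. For the fixed $c_0$ put $B_{c_0}(0)=\{x\in X:\|x\|_p\ll c_0\}$. A linear mapping $\Lambda:X\to Y$ is cone bounded if $\Lambda(B_{c_0}(0))$ is a cone bounded set in $Y$. $B(X,Y)$ denotes the set of all cone bounded linear mappings from $X$ into $Y$, equipped with the cone norm $\|\Lambda\|_p=\sup\{\|\Lambda(x)\|_p : x\in X,\ \|x\|_p\ll c_0\}$. *)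

theory Defs
  imports "HOL-Analysis.Analysis"
begin

definition ordering_cone :: "'e::banach set \<Rightarrow> bool" where
  "ordering_cone P \<longleftrightarrow>
     closed P \<and> P \<noteq> {} \<and> P \<noteq> {0} \<and>
     (\<forall>x\<in>P. \<forall>y\<in>P. \<forall>a b::real. 0 \<le> a \<longrightarrow> 0 \<le> b \<longrightarrow> a *\<^sub>R x + b *\<^sub>R y \<in> P) \<and>
     P \<inter> uminus ` P = {0}"

definition cone_le :: "'e::banach set \<Rightarrow> 'e \<Rightarrow> 'e \<Rightarrow> bool" where
  "cone_le P x y \<longleftrightarrow> y - x \<in> P"

definition cone_ll :: "'e::banach set \<Rightarrow> 'e \<Rightarrow> 'e \<Rightarrow> bool" where
  "cone_ll P x y \<longleftrightarrow> y - x \<in> interior P"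

definition normal_cone :: "'e::banach set \<Rightarrow> bool" where
  "normal_cone P \<longleftrightarrow>
     (\<exists>M::real. M > 0 \<and> (\<forall>x y. cone_le P 0 x \<and> cone_le P x y \<longrightarrow> norm x \<le> M * norm y))"

definition is_cone_ub :: "'e::banach set \<Rightarrow> 'e set \<Rightarrow> 'e \<Rightarrow> bool" where
  "is_cone_ub P S t \<longleftrightarrow> cone_le P 0 t \<and> (\<forall>a\<in>S. cone_le P a t)"

definition upper_bounded :: "'e::banach set \<Rightarrow> 'e set \<Rightarrow> bool" where
  "upper_bounded P S \<longleftrightarrow> (\<exists>t. is_cone_ub P S t)"

definition is_cone_lub :: "'e::banach set \<Rightarrow> 'e set \<Rightarrow> 'e \<Rightarrow> bool" where
  "is_cone_lub P S s \<longleftrightarrow> is_cone_ub P S s \<and> (\<forall>t. is_cone_ub P S t \<longrightarrow> cone_le P s t)"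

definition supremum_property :: "'e::banach set \<Rightarrow> bool" where
  "supremum_property P \<longleftrightarrow> (\<forall>S. S \<subseteq> P \<and> upper_bounded P S \<longrightarrow> (\<exists>s\<in>P. is_cone_lub P S s))"

text \<open>Least upper bounds are unique because \<open>P \<inter> - P = {0}\<close>; the value is unspecified for
  sets that have no least upper bound.\<close>

definition cone_Sup :: "'e::banach set \<Rightarrow> 'e set \<Rightarrow> 'e" where
  "cone_Sup P S = (THE s. is_cone_lub P S s)"

definition cone_normed_space :: "'e::banach set \<Rightarrow> ('x::real_vector \<Rightarrow> 'e) \<Rightarrow> bool" where
  "cone_normed_space P N \<longleftrightarrow>
     (\<forall>x. cone_le P 0 (N x) \<and> (N x = 0 \<longleftrightarrow> x = 0)) \<and>
     (\<forall>\<alpha> x. N (\<alpha> *\<^sub>R x) = \<bar>\<alpha>\<bar> *\<^sub>R N x) \<and>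
     (\<forall>x y. cone_le P (N (x + y)) (N x + N y))"

definition cone_converges ::
  "'e::banach set \<Rightarrow> ('x::real_vector \<Rightarrow> 'e) \<Rightarrow> (nat \<Rightarrow> 'x) \<Rightarrow> 'x \<Rightarrow> bool" where
  "cone_converges P N X x \<longleftrightarrow>
     (\<forall>c. cone_ll P 0 c \<longrightarrow> (\<exists>K. \<forall>n\<ge>K. cone_ll P (N (X n - x)) c))"

definition cone_Cauchy ::
  "'e::banach set \<Rightarrow> ('x::real_vector \<Rightarrow> 'e) \<Rightarrow> (nat \<Rightarrow> 'x) \<Rightarrow> bool" where
  "cone_Cauchy P N X \<longleftrightarrow>
     (\<forall>c. cone_ll P 0 c \<longrightarrow> (\<exists>K. \<forall>n\<ge>K. \<forall>m\<ge>K. cone_ll P (N (X n - X m)) c))"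

definition cone_banach_space :: "'e::banach set \<Rightarrow> ('x::real_vector \<Rightarrow> 'e) \<Rightarrow> bool" where
  "cone_banach_space P N \<longleftrightarrow>
     cone_normed_space P N \<and> (\<forall>X. cone_Cauchy P N X \<longrightarrow> (\<exists>x. cone_converges P N X x))"

text \<open>The element type is unconstrained so that this also applies to sets of maps, with the
  norm \<open>cone_onorm\<close> below.\<close>

definition cone_bounded_set :: "'e::banach set \<Rightarrow> ('x \<Rightarrow> 'e) \<Rightarrow> 'x set \<Rightarrow> bool" where
  "cone_bounded_set P N S \<longleftrightarrow> upper_bounded P (N ` S)"

definition cone_ball :: "'e::banach set \<Rightarrow> ('x \<Rightarrow> 'e) \<Rightarrow> 'e \<Rightarrow> 'x set" where
  "cone_ball P N c = {x. cone_ll P (N x) c}"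

definition cone_bounded_maps ::
  "'e::banach set \<Rightarrow> 'e \<Rightarrow> ('x::real_vector \<Rightarrow> 'e) \<Rightarrow> ('y::real_vector \<Rightarrow> 'e) \<Rightarrow> ('x \<Rightarrow> 'y) set" where
  "cone_bounded_maps P c\<^sub>0 NX NY =
     {\<Lambda>. linear \<Lambda> \<and> cone_bounded_set P NY (\<Lambda> ` cone_ball P NX c\<^sub>0)}"

definition cone_onorm ::
  "'e::banach set \<Rightarrow> 'e \<Rightarrow> ('x::real_vector \<Rightarrow> 'e) \<Rightarrow> ('y::real_vector \<Rightarrow> 'e) \<Rightarrow> ('x \<Rightarrow> 'y) \<Rightarrow> 'e" where
  "cone_onorm P c\<^sub>0 NX NY \<Lambda> = cone_Sup P {NY (\<Lambda> x) | x. cone_ll P (NX x) c\<^sub>0}"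

end

theory Submission
  imports Defs
begin

text \<open>
  The order unit \<open>c\<^sub>0\<close> turns cone norms into ordinary seminorms: the Minkowski functional
  \<open>v \<mapsto> Inf {t \<ge> 0. v \<le> t c\<^sub>0}\<close> is monotone and sublinear on \<open>P\<close>, and composing it with a cone norm
  gives a real seminorm with the same Cauchy and convergent sequences and the same bounded sets.
  The real uniform boundedness principle is then shown by Sokal's gliding hump, which avoids
  Baire's theorem: in an unbounded family pick \<open>T\<^sub>n\<close> of norm at least \<open>4 ^ n\<close>, and move by steps of
  length \<open>3 ^ -n\<close> so that \<open>T\<^sub>n\<close> is large at the limit point for every \<open>n\<close>.
\<close>

section \<open>Uniform boundedness for seminorms\<close>

definition real_seminorm :: "('x::real_vector \<Rightarrow> real) \<Rightarrow> bool" where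
  "real_seminorm p \<longleftrightarrow>
     (\<forall>x. 0 \<le> p x) \<and> (\<forall>a x. p (a *\<^sub>R x) = \<bar>a\<bar> * p x) \<and> (\<forall>x y. p (x + y) \<le> p x + p y)"

lemma
  assumes "real_seminorm p"
  shows real_seminorm_nonneg: "0 \<le> p x"
    and real_seminorm_scaleR: "p (a *\<^sub>R x) = \<bar>a\<bar> * p x"
    and real_seminorm_triangle: "p (x + y) \<le> p x + p y"
  using assms by (auto simp: real_seminorm_def)

lemma real_seminorm_zero: "real_seminorm p \<Longrightarrow> p 0 = 0"
  using real_seminorm_scaleR[of p 0 0] by simp

lemma real_seminorm_minus: "real_seminorm p \<Longrightarrow> p (- x) = p x"
  using real_seminorm_scaleR[of p "-1" x] by simp

lemma real_seminorm_minus_commute: "real_seminorm p \<Longrightarrow> p (x - y) = p (y - x)"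
  using real_seminorm_minus[of p "x - y"] by simp

text \<open>The reverse triangle inequality, in the form that carries a lower bound from an
  approximating point \<open>y\<close> over to its limit \<open>x\<close>.\<close>

lemma real_seminorm_linear_diff_ge:
  assumes "real_seminorm q" "linear T"
  shows "q (T y) - q (T (y - x)) \<le> q (T x)"
  using real_seminorm_triangle[OF assms(1), of "T (y - x)" "T x"]
  by (simp add: linear_diff[OF assms(2)])

text \<open>Since \<open>2 *\<^sub>R T z\<close> is the difference of \<open>T (x + z)\<close> and
  \<open>T (x - z)\<close>, one of the two signs always makes the image at least as large as
  \<open>T z\<close>, whatever \<open>x\<close> is.\<close>

lemma real_seminorm_linear_max:
  assumes q: "real_seminorm q" and T: "linear T"
  shows "q (T z) \<le> max (q (T (x + z))) (q (T (x - z)))"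
proof -
  have "2 * q (T z) = q (2 *\<^sub>R T z)"
    using real_seminorm_scaleR[OF q] by simp
  also have "2 *\<^sub>R T z = T (x + z) + - T (x - z)"
    by (simp add: linear_add[OF T] linear_diff[OF T] scaleR_2)
  also have "q \<dots> \<le> q (T (x + z)) + q (T (x - z))"
    using real_seminorm_triangle[OF q] real_seminorm_minus[OF q] by metis
  finally show ?thesis by linarith
qed

text \<open>Here \<open>K\<close> is the operator seminorm of \<open>T\<close>. The supremum over
  the unit ball need not be attained, so \<open>z\<close> reaches only the fraction 3/4 of
  it.\<close>

lemma seminorm_near_maximizer:
  assumes p: "real_seminorm p" and q: "real_seminorm q" and T: "linear T"
    and bdd: "\<And>x. q (T x) \<le> C * p x"
    and large: "B * p u < q (T u)" and "0 \<le> B"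
  obtains z K where "p z \<le> 1" "B < K" "3 / 4 * K \<le> q (T z)" "\<And>x. q (T x) \<le> K * p x"
proof -
  define S where "S = (\<lambda>x. q (T x)) ` {x. p x \<le> 1}"
  define K where "K = Sup S"
  have "bdd_above S"
  proof (rule bdd_aboveI)
    fix s assume "s \<in> S"
    then obtain x where x: "p x \<le> 1" "s = q (T x)" by (auto simp: S_def)
    have "C * p x \<le> \<bar>C\<bar> * 1"
      using x(1) real_seminorm_nonneg[OF p, of x] by (intro mult_mono) auto
    then show "s \<le> \<bar>C\<bar>" using bdd[of x] x(2) by simp
  qed
  then have le_K: "q (T x) \<le> K" if "p x \<le> 1" for x
    using that by (auto simp: S_def K_def intro: cSUP_upper)
  have K: "q (T x) \<le> K * p x" for x
  \<comment> \<open>Where \<open>p\<close> vanishes, \<open>x\<close> cannot be normalised; there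
    \<open>bdd\<close> already forces \<open>q (T x) \<le> 0\<close>.\<close>
  proof (cases "p x = 0")
    case True
    then show ?thesis using bdd[of x] by simp
  next
    case False
    then have pos: "p x > 0" using real_seminorm_nonneg[OF p, of x] by simp
    have "q (T ((1 / p x) *\<^sub>R x)) \<le> K"
      using pos by (intro le_K) (simp add: real_seminorm_scaleR[OF p])
    then show ?thesis
      using pos by (simp add: linear_scale[OF T] real_seminorm_scaleR[OF q] field_simps)
  qed
  have "B * p u < K * p u" using large K[of u] by simp
  then have BK: "B < K"
    using real_seminorm_nonneg[OF p, of u] by (simp add: mult_less_cancel_right)
  have "S \<noteq> {}" using real_seminorm_zero[OF p] by (auto simp: S_def intro!: exI[of _ 0])
  moreover have "3 / 4 * K < Sup S" using BK \<open>0 \<le> B\<close> by (simp add: K_def)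
  ultimately obtain s where "s \<in> S" "3 / 4 * K < s" using less_cSupD by blast
  then obtain z where "p z \<le> 1" "3 / 4 * K \<le> q (T z)" by (auto simp: S_def)
  then show thesis using BK K that by blast
qed

text \<open>Completeness is a hypothesis on \<open>p\<close>-Cauchy sequences because
  \<open>p\<close> is not the norm of a type.\<close>

theorem seminorm_uniform_boundedness:
  fixes p :: "'x::real_vector \<Rightarrow> real" and q :: "'y::real_vector \<Rightarrow> real"
  assumes p: "real_seminorm p" and q: "real_seminorm q"
    and complete: "\<And>X. (\<And>e. 0 < e \<Longrightarrow> \<exists>N. \<forall>n\<ge>N. \<forall>m\<ge>N. p (X n - X m) < e) \<Longrightarrow>
      \<exists>x. (\<lambda>n. p (X n - x)) \<longlonglongrightarrow> 0"
    and lin: "\<And>T. T \<in> A \<Longrightarrow> linear T"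
    and bdd: "\<And>T. T \<in> A \<Longrightarrow> \<exists>C. \<forall>x. q (T x) \<le> C * p x"
    and pointwise: "\<And>x. \<exists>C. \<forall>T\<in>A. q (T x) \<le> C"
  shows "\<exists>C\<ge>0. \<forall>T\<in>A. \<forall>x. q (T x) \<le> C * p x"
proof (rule ccontr)
  assume unbounded: "\<not> ?thesis"
  \<comment> \<open>The negated conclusion is applied with the constant
    \<open>4 ^ n\<close>.\<close>
  have "\<exists>T z K. T \<in> A \<and> p z \<le> 1 \<and> 4 ^ n < K \<and> 3 / 4 * K \<le> q (T z) \<and> (\<forall>x. q (T x) \<le> K * p x)"
    for n :: nat
  proof -
    obtain T u where T: "T \<in> A" "4 ^ n * p u < q (T u)"
      using unbounded by (meson not_le zero_le_numeral zero_le_power)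
    obtain C where "\<And>x. q (T x) \<le> C * p x" using bdd[OF T(1)] by blast
    from seminorm_near_maximizer[OF p q lin[OF T(1)] this T(2)] T(1) show ?thesis
      by (metis zero_le_numeral zero_le_power)
  qed
  then obtain T z K where T: "\<And>n. T n \<in> A" and z: "\<And>n. p (z n) \<le> 1"
    and K_gt: "\<And>n::nat. 4 ^ n < K n" and Kz: "\<And>n. 3 / 4 * K n \<le> q (T n (z n))"
    and K: "\<And>n x. q (T n x) \<le> K n * p x"
    by metis
  define w where "w n = (1 / 3 ^ n) *\<^sub>R z n" for n
  \<comment> \<open>\<open>X n\<close> is a signed sum of \<open>w 0\<close>, ...,
    \<open>w (n - 1)\<close>; each sign is chosen to keep the image under \<open>T n\<close> at
    least as large as that of \<open>w n\<close>.\<close>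
  define X where "X = rec_nat 0 (\<lambda>n x. if q (T n (w n)) \<le> q (T n (x + w n)) then x + w n else x - w n)"
  have X_Suc: "X (Suc n) = (if q (T n (w n)) \<le> q (T n (X n + w n)) then X n + w n else X n - w n)" for n
    by (simp add: X_def)
  have pw: "p (w n) \<le> 1 / 3 ^ n" for n
    using z[of n] by (simp add: w_def real_seminorm_scaleR[OF p] divide_right_mono)
  have X_large: "3 / 4 * K n / 3 ^ n \<le> q (T n (X (Suc n)))" for n
  proof -
    have "3 / 4 * K n / 3 ^ n \<le> q (T n (w n))"
      using divide_right_mono[OF Kz[of n], of "3 ^ n"]
      by (simp add: w_def linear_scale[OF lin[OF T]] real_seminorm_scaleR[OF q])
    also have "\<dots> \<le> q (T n (X (Suc n)))"
      using real_seminorm_linear_max[OF q lin[OF T], of n "w n" "X n"] by (auto simp: X_Suc)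
    finally show ?thesis .
  qed
  have step: "p (X (Suc n) - X n) \<le> 1 / 3 ^ n" for n
    using pw[of n] by (simp add: X_Suc real_seminorm_minus[OF p])
  \<comment> \<open>The right-hand side is the exact value of the finite geometric sum of the step
    bounds, which lets the induction close.\<close>
  have telescope: "p (X (n + k) - X n) \<le> 3 / 2 * (1 / 3 ^ n - 1 / 3 ^ (n + k))" for n k
  proof (induction k)
    case 0
    then show ?case by (simp add: real_seminorm_zero[OF p])
  next
    case (Suc k)
    have "p (X (n + Suc k) - X n) \<le> p (X (Suc (n + k)) - X (n + k)) + p (X (n + k) - X n)"
      using real_seminorm_triangle[OF p, of "X (Suc (n + k)) - X (n + k)" "X (n + k) - X n"] by simp
    also have "\<dots> \<le> 1 / 3 ^ (n + k) + 3 / 2 * (1 / 3 ^ n - 1 / 3 ^ (n + k))"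
      using step Suc by (rule add_mono)
    also have "\<dots> = 3 / 2 * (1 / 3 ^ n - 1 / 3 ^ (n + Suc k))"
      by (simp add: field_simps)
    finally show ?case .
  qed
  have X_dist: "p (X m - X n) \<le> 3 / 2 * (1 / 3) ^ n" if "n \<le> m" for m n
  proof -
    have "p (X m - X n) \<le> 3 / 2 * (1 / 3 ^ n - 1 / 3 ^ m)"
      using telescope[of n "m - n"] that by simp
    also have "\<dots> \<le> 3 / 2 * (1 / 3) ^ n" by (simp add: power_one_over)
    finally show ?thesis .
  qed
  have "\<exists>x. (\<lambda>n. p (X n - x)) \<longlonglongrightarrow> 0"
  proof (rule complete)
    fix e :: real assume "0 < e"
    \<comment> \<open>Two distances to \<open>X N\<close>, each at most
      \<open>3 / 2 * (1 / 3) ^ N\<close>, add up to less than \<open>e\<close>.\<close>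
    then obtain N where N: "(1 / 3) ^ N < e / 3"
      using real_arch_pow_inv[of "e / 3" "1 / 3"] by auto
    have "p (X n - X m) < e" if "N \<le> n" "N \<le> m" for n m
    proof -
      have "p (X n - X m) \<le> p (X n - X N) + p (X m - X N)"
        using real_seminorm_triangle[OF p, of "X n - X N" "X N - X m"]
        by (simp add: real_seminorm_minus_commute[OF p, of "X N"])
      also have "\<dots> \<le> 3 * (1 / 3) ^ N" using X_dist[OF that(1)] X_dist[OF that(2)] by simp
      also have "\<dots> < e" using N by simp
      finally show ?thesis .
    qed
    then show "\<exists>N. \<forall>n\<ge>N. \<forall>m\<ge>N. p (X n - X m) < e" by blast
  qed
  then obtain x where lim: "(\<lambda>n. p (X n - x)) \<longlonglongrightarrow> 0" by blast
  \<comment> \<open>The bound \<open>X_dist\<close> survives the limit in \<open>m\<close>, with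
    \<open>p (X m - x)\<close> as the vanishing error.\<close>
  have x_dist: "p (X n - x) \<le> 3 / 2 * (1 / 3) ^ n" for n
  proof (rule tendsto_lowerbound)
    show "(\<lambda>m. 3 / 2 * (1 / 3) ^ n + p (X m - x)) \<longlonglongrightarrow> 3 / 2 * (1 / 3) ^ n"
      using tendsto_add[OF tendsto_const lim] by simp
    show "\<forall>\<^sub>F m in sequentially. p (X n - x) \<le> 3 / 2 * (1 / 3) ^ n + p (X m - x)"
    proof (rule eventually_sequentiallyI)
      fix m assume "n \<le> m"
      then show "p (X n - x) \<le> 3 / 2 * (1 / 3) ^ n + p (X m - x)"
        using real_seminorm_triangle[OF p, of "X n - X m" "X m - x"] X_dist
        by (fastforce simp: real_seminorm_minus_commute[OF p, of "X n"])
    qed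
  qed simp
  \<comment> \<open>The hump of \<open>T n\<close> first appears in \<open>X (Suc n)\<close>, whose
    distance to \<open>x\<close> is at most \<open>1 / 2 * (1 / 3) ^ n\<close>. All later steps
    together thus cost \<open>T n\<close> at most \<open>K n / 2 / 3 ^ n\<close>, against a hump of
    \<open>3 / 4 * K n / 3 ^ n\<close>.\<close>
  have large: "1 / 4 * (4 / 3) ^ n \<le> q (T n x)" for n
  proof -
    have "0 < K n" using K_gt[of n] by (rule less_trans[rotated]) simp
    have "(4 / 3) ^ n \<le> K n / 3 ^ n"
      using K_gt[of n] by (simp add: power_divide divide_right_mono)
    then have "1 / 4 * (4 / 3) ^ n \<le> 3 / 4 * K n / 3 ^ n - K n * (1 / 2 * (1 / 3) ^ n)"
      by (simp add: power_one_over)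
    also have "\<dots> \<le> q (T n (X (Suc n))) - K n * p (X (Suc n) - x)"
      using X_large[of n] x_dist[of "Suc n"] \<open>0 < K n\<close> by (intro diff_mono) auto
    also have "\<dots> \<le> q (T n (X (Suc n))) - q (T n (X (Suc n) - x))" using K by simp
    also have "\<dots> \<le> q (T n x)" using real_seminorm_linear_diff_ge[OF q lin[OF T]] .
    finally show ?thesis .
  qed
  obtain C where C: "\<And>S. S \<in> A \<Longrightarrow> q (S x) \<le> C" using pointwise[of x] by blast
  obtain n where "4 * C < (4 / 3) ^ n" using real_arch_pow[of "4 / 3" "4 * C"] by auto
  then show False using large[of n] C[OF T[of n]] by simp
qed

section \<open>The Minkowski functional of an order unit\<close>

text \<open>The bound is one-sided, so this is a sublinear functional rather than a seminorm on
  \<open>E\<close>. The condition \<open>0 \<le> t\<close> makes the infimum range over a set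
  bounded below.\<close>

definition cone_gauge :: "'e::banach set \<Rightarrow> 'e \<Rightarrow> 'e \<Rightarrow> real" where
  "cone_gauge P c v = Inf {t. 0 \<le> t \<and> cone_le P v (t *\<^sub>R c)}"

lemma cone_gauge_le: "0 \<le> t \<Longrightarrow> cone_le P v (t *\<^sub>R c) \<Longrightarrow> cone_gauge P c v \<le> t"
  unfolding cone_gauge_def by (rule cInf_lower) (auto intro: bdd_belowI[of _ 0])

locale cone_with_unit =
  fixes P :: "'e::banach set" and c :: 'e
  assumes cone: "ordering_cone P" and unit: "c \<in> interior P"
begin

section \<open>Order and interior of the cone\<close>

lemma add_mem: "x \<in> P \<Longrightarrow> y \<in> P \<Longrightarrow> x + y \<in> P"
  using cone unfolding ordering_cone_def by (metis scaleR_one zero_le_one)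

lemma scaleR_mem: "x \<in> P \<Longrightarrow> 0 \<le> a \<Longrightarrow> a *\<^sub>R x \<in> P"
  using cone unfolding ordering_cone_def
  by (metis add.right_neutral order_refl scaleR_zero_left)

lemma unit_mem: "c \<in> P"
  using unit interior_subset by blast

lemma cone_le_trans: "cone_le P x y \<Longrightarrow> cone_le P y z \<Longrightarrow> cone_le P x z"
  using add_mem[of "y - x" "z - y"] by (simp add: cone_le_def)

lemma cone_le_antisym:
  assumes "cone_le P x y" "cone_le P y x"
  shows "x = y"
proof -
  have "y - x \<in> P \<inter> uminus ` P"
    using assms by (auto simp: cone_le_def intro!: image_eqI[of _ _ "x - y"])
  then have "y - x = 0" using cone unfolding ordering_cone_def by blast
  then show ?thesis by simp
qed

lemma scaleR_unit_mono: "s \<le> t \<Longrightarrow> cone_le P (s *\<^sub>R c) (t *\<^sub>R c)"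
  using scaleR_mem[OF unit_mem, of "t - s"] by (simp add: cone_le_def scaleR_left_diff_distrib)

text \<open>A translate of the interior by an element of \<open>P\<close> is an open subset of
  \<open>P\<close>.\<close>

lemma add_mem_interior:
  assumes "x \<in> P" "y \<in> interior P"
  shows "x + y \<in> interior P"
proof (rule interiorI)
  show "open ((+) x ` interior P)" by (rule open_translation) simp
  show "x + y \<in> (+) x ` interior P" using assms(2) by blast
  show "(+) x ` interior P \<subseteq> P" using assms(1) add_mem interior_subset by blast
qed

lemma scaleR_mem_interior:
  assumes "x \<in> interior P" "0 < a"
  shows "a *\<^sub>R x \<in> interior P"
proof (rule interiorI)
  show "open ((*\<^sub>R) a ` interior P)" using assms(2) by (intro open_scaling) auto
  show "a *\<^sub>R x \<in> (*\<^sub>R) a ` interior P" using assms(1) by blast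
  show "(*\<^sub>R) a ` interior P \<subseteq> P" using assms(2) scaleR_mem interior_subset by fastforce
qed

lemma cone_le_ll_trans: "cone_le P x y \<Longrightarrow> cone_ll P y z \<Longrightarrow> cone_ll P x z"
  using add_mem_interior[of "y - x" "z - y"] by (simp add: cone_le_def cone_ll_def)

lemma cone_ll_imp_le: "cone_ll P x y \<Longrightarrow> cone_le P x y"
  unfolding cone_le_def cone_ll_def using interior_subset by blast

lemma scaleR_unit_ll: "s < t \<Longrightarrow> cone_ll P (s *\<^sub>R c) (t *\<^sub>R c)"
  using scaleR_mem_interior[OF unit, of "t - s"] by (simp add: cone_ll_def scaleR_left_diff_distrib)

text \<open>Openness of the interior along a ray. It shows that the unit absorbs every vector, and
  that every \<open>d\<close> in the interior dominates a positive multiple of the unit.\<close>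

lemma small_perturbation_mem:
  assumes "x \<in> interior P"
  obtains e where "0 < e" "x - e *\<^sub>R v \<in> interior P"
proof -
  have "((\<lambda>e. x - e *\<^sub>R v) \<longlongrightarrow> x - 0 *\<^sub>R v) (at_right 0)" by (intro tendsto_intros)
  then have "\<forall>\<^sub>F e in at_right 0. x - e *\<^sub>R v \<in> interior P"
    using assms by (intro topological_tendstoD) auto
  then have "\<forall>\<^sub>F e in at_right (0::real). 0 < e \<and> x - e *\<^sub>R v \<in> interior P"
    using eventually_at_right_less by eventually_elim auto
  then have "\<exists>e>0. x - e *\<^sub>R v \<in> interior P"
    by (intro eventually_happens'[of "at_right 0"]) simp_all
  then show thesis using that by blast
qed

lemma unit_absorbs: obtains t where "0 \<le> t" "cone_le P v (t *\<^sub>R c)"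
proof -
  obtain e where e: "0 < e" "c - e *\<^sub>R v \<in> interior P"
    using small_perturbation_mem[OF unit] .
  then have "(1 / e) *\<^sub>R (c - e *\<^sub>R v) \<in> P" using scaleR_mem interior_subset by fastforce
  then have "cone_le P v ((1 / e) *\<^sub>R c)" using e(1) by (simp add: cone_le_def scaleR_right_diff_distrib)
  then show thesis using e(1) that[of "1 / e"] by simp
qed

section \<open>Monotonicity and sublinearity of the gauge\<close>

lemma cone_gauge_nonneg: "0 \<le> cone_gauge P c v"
  unfolding cone_gauge_def using unit_absorbs[of v] by (intro cInf_greatest) auto

text \<open>The infimum is attained because \<open>P\<close> is closed.\<close>

lemma cone_le_cone_gauge: "cone_le P v (cone_gauge P c v *\<^sub>R c)"
proof -
  let ?S = "{t. 0 \<le> t \<and> cone_le P v (t *\<^sub>R c)}"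
  have "closed ((\<lambda>t. t *\<^sub>R c - v) -` P)"
    using cone by (intro closed_vimage continuous_intros) (auto simp: ordering_cone_def)
  moreover have "?S = {0..} \<inter> (\<lambda>t. t *\<^sub>R c - v) -` P" by (auto simp: cone_le_def)
  ultimately have "closed ?S" by (simp add: closed_Int)
  moreover have "?S \<noteq> {}" using unit_absorbs[of v] by auto
  ultimately have "Inf ?S \<in> ?S" by (intro closed_contains_Inf) (auto intro: bdd_belowI[of _ 0])
  then show ?thesis by (simp add: cone_gauge_def)
qed

lemma cone_gauge_mono: "cone_le P v w \<Longrightarrow> cone_gauge P c v \<le> cone_gauge P c w"
  by (blast intro: cone_gauge_le cone_gauge_nonneg cone_le_trans cone_le_cone_gauge)

lemma cone_gauge_add: "cone_gauge P c (v + w) \<le> cone_gauge P c v + cone_gauge P c w"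
  using add_mem[OF cone_le_cone_gauge[of v, unfolded cone_le_def] cone_le_cone_gauge[of w, unfolded cone_le_def]]
  by (intro cone_gauge_le)
     (auto simp: cone_gauge_nonneg cone_le_def scaleR_left_distrib algebra_simps)

lemma cone_gauge_scaleR_le: "0 \<le> a \<Longrightarrow> cone_gauge P c (a *\<^sub>R v) \<le> a * cone_gauge P c v"
  using scaleR_mem[OF cone_le_cone_gauge[of v, unfolded cone_le_def], of a]
  by (intro cone_gauge_le) (auto simp: cone_gauge_nonneg cone_le_def scaleR_right_diff_distrib)

lemma cone_gauge_scaleR:
  assumes "0 \<le> a"
  shows "cone_gauge P c (a *\<^sub>R v) = a * cone_gauge P c v"
proof (cases "a = 0")
  case True
  then show ?thesis using cone_gauge_scaleR_le[of 0 v] cone_gauge_nonneg[of 0] by simp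
next
  case False
  \<comment> \<open>The converse inequality is the same one for the factor \<open>1 / a\<close> and
    the vector \<open>a *\<^sub>R v\<close>.\<close>
  then have "a * cone_gauge P c v \<le> cone_gauge P c (a *\<^sub>R v)"
    using assms cone_gauge_scaleR_le[of "1 / a" "a *\<^sub>R v"] by (simp add: field_simps)
  then show ?thesis using cone_gauge_scaleR_le[OF assms] by (simp add: antisym)
qed

section \<open>Cone norms seen through the gauge\<close>

lemma real_seminorm_cone_gauge:
  assumes "cone_normed_space P N"
  shows "real_seminorm (\<lambda>x. cone_gauge P c (N x))"
  unfolding real_seminorm_def
proof (intro conjI allI)
  show "cone_gauge P c (N (x + y)) \<le> cone_gauge P c (N x) + cone_gauge P c (N y)" for x y
    using assms cone_gauge_mono cone_gauge_add unfolding cone_normed_space_def by (meson order_trans)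
\<comment> \<open>Positive homogeneity of the gauge suffices, as the cone norm itself turns a scalar
  into its absolute value.\<close>
qed (use assms in \<open>auto simp: cone_normed_space_def cone_gauge_nonneg cone_gauge_scaleR\<close>)

lemma cone_gauge_less_imp_ll: "cone_gauge P c v < t \<Longrightarrow> cone_ll P v (t *\<^sub>R c)"
  using cone_le_ll_trans[OF cone_le_cone_gauge scaleR_unit_ll] .

lemma cone_banach_space_gauge_complete:
  assumes N: "cone_banach_space P N"
    and Cauchy: "\<And>e. 0 < e \<Longrightarrow> \<exists>K. \<forall>n\<ge>K. \<forall>m\<ge>K. cone_gauge P c (N (X n - X m)) < e"
  shows "\<exists>x. (\<lambda>n. cone_gauge P c (N (X n - x))) \<longlonglongrightarrow> 0"
proof -
  have "cone_Cauchy P N X"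
    unfolding cone_Cauchy_def
  proof (intro allI impI)
    fix d assume "cone_ll P 0 d"
    then obtain e where e: "0 < e" "cone_ll P (e *\<^sub>R c) d"
      using small_perturbation_mem[of d c] by (auto simp: cone_ll_def)
    obtain K where "\<forall>n\<ge>K. \<forall>m\<ge>K. cone_gauge P c (N (X n - X m)) < e"
      using Cauchy[OF e(1)] by blast
    then show "\<exists>K. \<forall>n\<ge>K. \<forall>m\<ge>K. cone_ll P (N (X n - X m)) d"
      by (meson cone_gauge_less_imp_ll cone_ll_imp_le cone_le_ll_trans e(2))
  qed
  then obtain x where x: "cone_converges P N X x" using N by (auto simp: cone_banach_space_def)
  have "(\<lambda>n. cone_gauge P c (N (X n - x))) \<longlonglongrightarrow> 0"
  proof (rule LIMSEQ_I)
    fix r :: real assume "0 < r"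
    \<comment> \<open>Half of \<open>r\<close>, because \<open>cone_gauge_le\<close> returns only a
      non-strict bound.\<close>
    then have "cone_ll P 0 ((r / 2) *\<^sub>R c)" using scaleR_unit_ll[of 0 "r / 2"] by simp
    then obtain K where "\<forall>n\<ge>K. cone_ll P (N (X n - x)) ((r / 2) *\<^sub>R c)"
      using x unfolding cone_converges_def by blast
    then have "\<forall>n\<ge>K. cone_gauge P c (N (X n - x)) \<le> r / 2"
      using \<open>0 < r\<close> cone_gauge_le[OF _ cone_ll_imp_le, of "r / 2"] by simp
    then show "\<exists>K. \<forall>n\<ge>K. norm (cone_gauge P c (N (X n - x)) - 0) < r"
      using \<open>0 < r\<close> cone_gauge_nonneg by (auto intro!: exI[of _ K] simp: order_le_less_trans)
  qed
  then show ?thesis ..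
qed

lemma cone_bounded_set_gauge:
  assumes "cone_bounded_set P N S"
  shows "\<exists>C\<ge>0. \<forall>x\<in>S. cone_gauge P c (N x) \<le> C"
  using assms cone_gauge_mono cone_gauge_nonneg
  unfolding cone_bounded_set_def upper_bounded_def is_cone_ub_def by blast

lemma cone_bounded_maps_gauge:
  assumes NX: "cone_normed_space P NX" and NY: "cone_normed_space P NY"
    and T: "T \<in> cone_bounded_maps P c NX NY"
  shows "\<exists>C. \<forall>x. cone_gauge P c (NY (T x)) \<le> C * cone_gauge P c (NX x)"
proof -
  let ?p = "\<lambda>x. cone_gauge P c (NX x)" and ?q = "\<lambda>y. cone_gauge P c (NY y)"
  note p = real_seminorm_cone_gauge[OF NX] and q = real_seminorm_cone_gauge[OF NY]
  have lin: "linear T" using T by (simp add: cone_bounded_maps_def)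
  obtain C where C: "0 \<le> C" "\<And>x. cone_ll P (NX x) c \<Longrightarrow> ?q (T x) \<le> C"
    using T cone_bounded_set_gauge by (fastforce simp: cone_bounded_maps_def cone_ball_def)
  \<comment> \<open>Dividing by some \<open>s\<close> strictly above the gauge puts \<open>x\<close>
    into the open ball and also covers gauge zero; afterwards \<open>s\<close> decreases to the
    gauge.\<close>
  have bound: "?q (T x) \<le> C * s" if "?p x < s" for x s
  proof -
    have s: "0 < s" using that cone_gauge_nonneg[of "NX x"] by linarith
    have "?p ((1 / s) *\<^sub>R x) < 1" using that s by (simp add: real_seminorm_scaleR[OF p])
    then have "?q (T ((1 / s) *\<^sub>R x)) \<le> C"
      using cone_gauge_less_imp_ll[of _ 1] C(2) by simp
    then show ?thesis
      using s by (simp add: linear_scale[OF lin] real_seminorm_scaleR[OF q] field_simps)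
  qed
  have "?q (T x) \<le> C * ?p x" for x
  proof (rule tendsto_lowerbound)
    show "((\<lambda>s. C * s) \<longlongrightarrow> C * ?p x) (at_right (?p x))" by (intro tendsto_intros)
    show "\<forall>\<^sub>F s in at_right (?p x). ?q (T x) \<le> C * s"
      using eventually_at_right_less by eventually_elim (rule bound)
  qed simp
  then show ?thesis by blast
qed

text \<open>The description in \<open>cone_Sup\<close> is proper: existence comes from the supremum
  property, uniqueness from antisymmetry.\<close>

lemma is_cone_lub_cone_Sup:
  assumes "supremum_property P" "S \<subseteq> P" "is_cone_ub P S t"
  shows "is_cone_lub P S (cone_Sup P S)"
proof -
  obtain s where "is_cone_lub P S s"
    using assms unfolding supremum_property_def upper_bounded_def by blast
  then show ?thesis
    unfolding cone_Sup_def
    by (rule theI) (use \<open>is_cone_lub P S s\<close> in \<open>auto simp: is_cone_lub_def intro: cone_le_antisym\<close>)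
qed

text \<open>Points of the ball have gauge at most 1, so \<open>C *\<^sub>R c\<close> is an upper
  bound of the set whose supremum is the operator norm.\<close>

lemma cone_onorm_le:
  assumes sup: "supremum_property P" and NY: "cone_normed_space P NY" and "0 \<le> C"
    and bound: "\<And>x. cone_gauge P c (NY (T x)) \<le> C * cone_gauge P c (NX x)"
  shows "cone_le P (cone_onorm P c NX NY T) (C *\<^sub>R c)"
proof -
  let ?S = "{NY (T x) | x. cone_ll P (NX x) c}"
  have "cone_le P (NY (T x)) (C *\<^sub>R c)" if "cone_ll P (NX x) c" for x
  proof -
    have "cone_gauge P c (NX x) \<le> 1" using that cone_gauge_le[OF _ cone_ll_imp_le, of 1] by simp
    then have "C * cone_gauge P c (NX x) \<le> C" using \<open>0 \<le> C\<close> by (simp add: mult_left_le)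
    then have "cone_gauge P c (NY (T x)) \<le> C" using bound by (rule order_trans[rotated])
    then show ?thesis by (rule cone_le_trans[OF cone_le_cone_gauge scaleR_unit_mono])
  qed
  then have ub: "is_cone_ub P ?S (C *\<^sub>R c)"
    using scaleR_unit_mono[OF \<open>0 \<le> C\<close>] by (auto simp: is_cone_ub_def)
  have "?S \<subseteq> P" using NY by (auto simp: cone_normed_space_def cone_le_def)
  from is_cone_lub_cone_Sup[OF sup this ub] ub show ?thesis
    by (auto simp: cone_onorm_def is_cone_lub_def)
qed

end

section \<open>Uniform boundedness for cone norms\<close>

theorem theorem2p14:
  fixes P :: "'e::banach set" and c\<^sub>0 :: 'e
    and NX :: "'x::real_vector \<Rightarrow> 'e" and NY :: "'y::real_vector \<Rightarrow> 'e"
    and A :: "('x \<Rightarrow> 'y) set"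
  assumes "ordering_cone P" and "normal_cone P" and "interior P \<noteq> {}"
    and "supremum_property P"
    and "cone_ll P 0 c\<^sub>0"
    and "cone_banach_space P NX"
    and "cone_normed_space P NY"
    and "A \<subseteq> cone_bounded_maps P c\<^sub>0 NX NY"
    and "\<And>x. cone_bounded_set P NY {T x | T. T \<in> A}"
  shows "cone_bounded_set P (cone_onorm P c\<^sub>0 NX NY) A"
proof -
  interpret cone_with_unit P c\<^sub>0
    using assms(1,5) by unfold_locales (auto simp: cone_ll_def)
  have NX: "cone_normed_space P NX" using assms(6) by (simp add: cone_banach_space_def)
  have "\<exists>C\<ge>0. \<forall>T\<in>A. \<forall>x. cone_gauge P c\<^sub>0 (NY (T x)) \<le> C * cone_gauge P c\<^sub>0 (NX x)"
  proof (rule seminorm_uniform_boundedness)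
    show "real_seminorm (\<lambda>x. cone_gauge P c\<^sub>0 (NX x))" "real_seminorm (\<lambda>y. cone_gauge P c\<^sub>0 (NY y))"
      using NX assms(7) by (auto intro: real_seminorm_cone_gauge)
    show "linear T" if "T \<in> A" for T
      using that assms(8) by (auto simp: cone_bounded_maps_def)
    show "\<exists>C. \<forall>x. cone_gauge P c\<^sub>0 (NY (T x)) \<le> C * cone_gauge P c\<^sub>0 (NX x)" if "T \<in> A" for T
      using that assms(8) by (intro cone_bounded_maps_gauge NX assms(7)) auto
    show "\<exists>C. \<forall>T\<in>A. cone_gauge P c\<^sub>0 (NY (T x)) \<le> C" for x
      using cone_bounded_set_gauge[OF assms(9)[of x]] by blast
  qed (rule cone_banach_space_gauge_complete[OF assms(6)])
  then obtain C where C: "0 \<le> C"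
    and bound: "\<And>T x. T \<in> A \<Longrightarrow> cone_gauge P c\<^sub>0 (NY (T x)) \<le> C * cone_gauge P c\<^sub>0 (NX x)"
    by blast
  \<comment> \<open>The real constant becomes a vector bound common to all of
    \<open>A\<close>.\<close>
  have "cone_le P (cone_onorm P c\<^sub>0 NX NY T) (C *\<^sub>R c\<^sub>0)" if "T \<in> A" for T
    using assms(4,7) C bound[OF that] by (rule cone_onorm_le)
  then have "is_cone_ub P (cone_onorm P c\<^sub>0 NX NY ` A) (C *\<^sub>R c\<^sub>0)"
    using scaleR_unit_mono[OF C] by (auto simp: is_cone_ub_def)
  then show ?thesis by (auto simp: cone_bounded_set_def upper_bounded_def)
qed

end
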